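(* Let $\phi:\mathbb{R}\to\mathbb{R}$ be either the ReLU function $\phi(z)=\max\{z,0\}$ or the Heaviside function $\phi(z)=\mathbf{1}[z>0]$. Then, for every $\sigma_w>0$, $\sigma_b\ge0$, $N\ge2$ and every input $x_{0,:}\in\{-1,1\}^N$, in the random width-$N$ network with activation $\phi$ and parameters $\sigma_w,\sigma_b$, the random variables $h_{2,1},\dots,h_{2,N}$ are not independent.
   Context: Random network of width $N$ and depth $D\ge 2$: $\mathrm{Gauss}(0,s^2)$ denotes the normal distribution with mean $0$ and variance $s^2$ (the point mass at $0$ if $s=0$). Fix an input $x_{0,:}\in\{-1,1\}^N$. All entries of $W\in\mathbb{R}^{D\times N\times N}$ and $b\in\mathbb{R}^{D\times N}$ are independent, with $W_{\ell,i,j}\sim\mathrm{Gauss}(0,\sigma_w^2/N)$ and $b_{\ell,i}\sim\mathrm{Gauss}(0,\sigma_b^2)$. For $\ell=1,\dots,D$ and $i=1,\dots,N$, $$h_{\ell,i}=\sum_{j=1}^N W_{\ell,i,j}\,x_{\ell-1,j}+b_{\ell,i},\qquad x_{\ell,i}=\phi(h_{\ell,i}).$$ *)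

theory Defs
  imports "HOL-Probability.Probability"
begin

text \<open>The second argument is the variance, whereas \<^const>\<open>normal_density\<close> takes the
  standard deviation; variance \<open>0\<close> gives a point mass.\<close>

definition gauss :: "real \<Rightarrow> real \<Rightarrow> real measure" where
  "gauss \<mu> v = (if v = 0 then return borel \<mu>
                else density lborel (\<lambda>x. ennreal (normal_density \<mu> (sqrt v) x)))"

definition relu :: "real \<Rightarrow> real" where
  "relu z = max z 0"

definition heaviside :: "real \<Rightarrow> real" where
  "heaviside z = (if z > 0 then 1 else 0)"

definition affine_layer ::
    "nat \<Rightarrow> (nat \<Rightarrow> nat \<Rightarrow> real) \<Rightarrow> (nat \<Rightarrow> real) \<Rightarrow> (nat \<Rightarrow> real) \<Rightarrow> nat \<Rightarrow> real" where
  "affine_layer N A c y i = (\<Sum>j=1..N. A i j * y j) + c i"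

text \<open>\<open>post_act \<phi> N w c x0 l i\<close> is $x_{l,i}$ and \<open>pre_act \<phi> N w c x0 l i\<close> is $h_{l,i}$
  (for $l \ge 1$) in the width-\<open>N\<close> network with fixed weights \<open>w\<close>, biases \<open>c\<close> and input \<open>x0\<close>.
  Layers and neurons are numbered from \<open>1\<close>.\<close>

primrec post_act ::
    "(real \<Rightarrow> real) \<Rightarrow> nat \<Rightarrow> (nat \<Rightarrow> nat \<Rightarrow> nat \<Rightarrow> real) \<Rightarrow> (nat \<Rightarrow> nat \<Rightarrow> real) \<Rightarrow>
     (nat \<Rightarrow> real) \<Rightarrow> nat \<Rightarrow> nat \<Rightarrow> real" where
  "post_act \<phi> N w c x0 0 = x0"
| "post_act \<phi> N w c x0 (Suc l) =
     (\<lambda>i. \<phi> (affine_layer N (w (Suc l)) (c (Suc l)) (post_act \<phi> N w c x0 l) i))"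

definition pre_act ::
    "(real \<Rightarrow> real) \<Rightarrow> nat \<Rightarrow> (nat \<Rightarrow> nat \<Rightarrow> nat \<Rightarrow> real) \<Rightarrow> (nat \<Rightarrow> nat \<Rightarrow> real) \<Rightarrow>
     (nat \<Rightarrow> real) \<Rightarrow> nat \<Rightarrow> nat \<Rightarrow> real" where
  "pre_act \<phi> N w c x0 l = affine_layer N (w l) (c l) (post_act \<phi> N w c x0 (l - 1))"

lemma post_act_eq_pre_act:
  "l \<ge> 1 \<Longrightarrow> post_act \<phi> N w c x0 l i = \<phi> (pre_act \<phi> N w c x0 l i)"
  by (cases l) (simp_all add: pre_act_def)

text \<open>The disjoint sum of index sets makes all weights and biases jointly independent.\<close>

locale random_network = prob_space M for M :: "'a measure" +
  fixes D N :: nat and \<sigma>w \<sigma>b :: real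
    and W :: "nat \<Rightarrow> nat \<Rightarrow> nat \<Rightarrow> 'a \<Rightarrow> real" and b :: "nat \<Rightarrow> nat \<Rightarrow> 'a \<Rightarrow> real"
  assumes indep_params:
      "indep_vars (\<lambda>_. borel) (case_sum (\<lambda>(l, i, j). W l i j) (\<lambda>(l, i). b l i))
         (({1..D} \<times> {1..N} \<times> {1..N}) <+> ({1..D} \<times> {1..N}))"
    and distr_W: "\<And>l i j. l \<in> {1..D} \<Longrightarrow> i \<in> {1..N} \<Longrightarrow> j \<in> {1..N} \<Longrightarrow>
      distr M borel (W l i j) = gauss 0 (\<sigma>w\<^sup>2 / real N)"
    and distr_b: "\<And>l i. l \<in> {1..D} \<Longrightarrow> i \<in> {1..N} \<Longrightarrow>
      distr M borel (b l i) = gauss 0 (\<sigma>b\<^sup>2)"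
begin

lemma measurable_W:
  assumes "l \<in> {1..D}" "i \<in> {1..N}" "j \<in> {1..N}"
  shows "W l i j \<in> borel_measurable M"
proof -
  have "Inl (l, i, j) \<in> ({1..D} \<times> {1..N} \<times> {1..N}) <+> ({1..D} \<times> {1..N})"
    using assms by auto
  then have "random_variable borel (case_sum (\<lambda>(l, i, j). W l i j) (\<lambda>(l, i). b l i) (Inl (l, i, j)))"
    using indep_params unfolding indep_vars_def by blast
  then show ?thesis by simp
qed

lemma measurable_b:
  assumes "l \<in> {1..D}" "i \<in> {1..N}"
  shows "b l i \<in> borel_measurable M"
proof -
  have "Inr (l, i) \<in> ({1..D} \<times> {1..N} \<times> {1..N}) <+> ({1..D} \<times> {1..N})"
    using assms by auto
  then have "random_variable borel (case_sum (\<lambda>(l, i, j). W l i j) (\<lambda>(l, i). b l i) (Inr (l, i)))"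
    using indep_params unfolding indep_vars_def by blast
  then show ?thesis by simp
qed

lemma measurable_post_act:
  assumes [measurable]: "\<phi> \<in> borel_measurable borel" and "l \<le> D" "i \<in> {1..N}"
  shows "(\<lambda>\<omega>. post_act \<phi> N (\<lambda>l i j. W l i j \<omega>) (\<lambda>l i. b l i \<omega>) x0 l i) \<in> borel_measurable M"
  using assms(2,3)
proof (induction l arbitrary: i)
  case 0
  then show ?case by simp
next
  case (Suc l)
  have "(\<lambda>\<omega>. affine_layer N (\<lambda>i j. W (Suc l) i j \<omega>) (\<lambda>i. b (Suc l) i \<omega>)
      (post_act \<phi> N (\<lambda>l i j. W l i j \<omega>) (\<lambda>l i. b l i \<omega>) x0 l) i) \<in> borel_measurable M"
    unfolding affine_layer_def using Suc
    by (intro borel_measurable_add borel_measurable_sum borel_measurable_times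
        measurable_W measurable_b) auto
  from measurable_compose[OF this assms(1)] show ?case by simp
qed

text \<open>\<^const>\<open>indep_vars\<close> also demands measurability; this always holds for the
  pre-activations, so a failure of \<^const>\<open>indep_vars\<close> is a failure of independence.\<close>

lemma measurable_pre_act:
  assumes "\<phi> \<in> borel_measurable borel" "l \<in> {1..D}" "i \<in> {1..N}"
  shows "(\<lambda>\<omega>. pre_act \<phi> N (\<lambda>l i j. W l i j \<omega>) (\<lambda>l i. b l i \<omega>) x0 l i) \<in> borel_measurable M"
  unfolding pre_act_def affine_layer_def using assms
  by (intro borel_measurable_add borel_measurable_sum borel_measurable_times
      measurable_W measurable_b measurable_post_act) auto

end

lemma measurable_relu: "relu \<in> borel_measurable borel"
  unfolding relu_def by measurable

lemma measurable_heaviside: "heaviside \<in> borel_measurable borel"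
  unfolding heaviside_def by measurable

end

theory Submission
  imports Defs
begin

text \<open>Conditionally on the first layer, the \<open>h\<^sub>2\<^sub>,\<^sub>i\<close> are independent centred Gaussians with the common
  variance \<open>V = \<sigma>\<^sub>w\<^sup>2/N \<Sum>\<^sub>j x\<^sub>1\<^sub>,\<^sub>j\<^sup>2 + \<sigma>\<^sub>b\<^sup>2\<close>. With \<open>U = exp (- V / 2)\<close>, the characteristic function of
  \<open>h\<^sub>2\<^sub>,\<^sub>1\<close> and of \<open>h\<^sub>2\<^sub>,\<^sub>2\<close> at \<open>1\<close> is \<open>E U\<close>, while that of \<open>(h\<^sub>2\<^sub>,\<^sub>1, h\<^sub>2\<^sub>,\<^sub>2)\<close> at \<open>(1, 1)\<close> is \<open>E U\<^sup>2\<close>.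
  Independence would therefore force \<open>Var U = 0\<close>. But the events that all first-layer
  pre-activations are positive, respectively negative, both have positive probability, and
  \<open>V\<close> is strictly larger on the former.\<close>

section \<open>Centred Gaussians: characteristic function and mass of half-lines\<close>

text \<open>For positive variance, rescaling reduces the claim to the standard normal law; the point
  mass at 0 gives the same formula with \<open>v = 0\<close>.\<close>

lemma char_gauss:
  assumes "v \<ge> 0"
  shows "char (gauss 0 v) t = complex_of_real (exp (- (t\<^sup>2 * v) / 2))"
proof (cases "v = 0")
  case True
  then show ?thesis
    by (simp add: char_def gauss_def integral_return)
next
  case False
  define s where "s = sqrt v"
  have s: "s > 0" "s\<^sup>2 = v" using assms False by (auto simp: s_def)
  let ?G = "density lborel (\<lambda>x. ennreal (normal_density 0 s x))"
  interpret prob_space ?G by (rule prob_space_normal_density) (rule s)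
  have "distributed ?G lborel (\<lambda>x. x) (normal_density 0 s)"
    by (auto simp: distributed_def distr_id2)
  then have "distributed ?G lborel (\<lambda>x. x / s) std_normal_density"
    using normal_standard_normal_convert[OF s(1), of "\<lambda>x. x" 0] by simp
  then have D: "distr ?G lborel (\<lambda>x. x / s) = std_normal_distribution"
    by (simp add: distributed_def)
  \<comment> \<open>Splitting \<open>t * x\<close> as \<open>(t * s) * (x / s)\<close> makes the
    integrand a function of the standardised variable.\<close>
  have "char (gauss 0 v) t = (CLINT x|?G. iexp ((t * s) * (x / s)))"
    using False s by (simp add: char_def gauss_def s_def)
  also have "\<dots> = (CLINT y|distr ?G lborel (\<lambda>x. x / s). iexp ((t * s) * y))"
    by (subst integral_distr) auto
  also have "\<dots> = char std_normal_distribution (t * s)"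
    unfolding D char_def ..
  also have "\<dots> = complex_of_real (exp (- (t\<^sup>2 * v) / 2))"
    by (simp add: char_std_normal_distribution power_mult_distrib s)
  finally show ?thesis .
qed

text \<open>For \<open>v > 0\<close> the density is positive everywhere, so a Gaussian null set is
  Lebesgue null, which a set containing a half-line is not. For \<open>v = 0\<close> all mass sits
  at 0, hence the condition \<open>0 \<in> A\<close> in that case.\<close>

lemma gauss_pos:
  assumes "v \<ge> 0" "v > 0 \<or> 0 \<in> A" "A \<in> sets borel" "{..<0} \<subseteq> A \<or> {0<..} \<subseteq> A"
  shows "measure (gauss 0 v) A > 0"
proof (cases "v = 0")
  case True
  then show ?thesis using assms by (simp add: gauss_def measure_return)
next
  case False
  let ?G = "density lborel (\<lambda>x. ennreal (normal_density 0 (sqrt v) x))"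
  have s: "sqrt v > 0" using assms False by simp
  interpret prob_space ?G by (rule prob_space_normal_density) (rule s)
  have "emeasure ?G A \<noteq> 0"
  proof
    assume "emeasure ?G A = 0"
    then have "A \<in> null_sets ?G" using assms by auto
    then have "AE x in lborel. x \<notin> A"
      using normal_density_pos[OF s] by (auto simp: null_sets_density_iff less_imp_neq[symmetric])
    then have "A \<in> null_sets lborel"
      using assms by (simp add: AE_iff_null_sets)
    then have "emeasure lborel A = 0" by auto
    moreover have "emeasure lborel {-1 ..<0::real} = 1" "emeasure lborel {0<..1::real} = 1"
      by auto
    moreover have "{-1..<0} \<subseteq> A \<or> {0<..1} \<subseteq> A"
      using assms(4) by (auto simp: subset_eq)
    ultimately show False
      using emeasure_mono[of _ A lborel] assms(3) by (metis le_zero_eq sets_lborel zero_neq_one)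
  qed
  then show ?thesis using False by (simp add: gauss_def emeasure_eq_measure zero_less_measure_iff)
qed

section \<open>Linear forms in Gaussians with independent random coefficients\<close>

text \<open>This replaces conditioning by Fubini: the blocks \<open>A\<close> and \<open>B\<close>
  are independent, so the coefficients, which depend on block \<open>A\<close> only, can be frozen
  while block \<open>B\<close> is integrated out. For frozen coefficients the integral is a product
  of Gaussian characteristic functions.\<close>

lemma (in prob_space) expectation_iexp_random_linear_gauss:
  fixes Z :: "'i \<Rightarrow> 'a \<Rightarrow> real" and c :: "'i \<Rightarrow> ('i \<Rightarrow> real) \<Rightarrow> real"
  assumes ind: "indep_vars (\<lambda>_. borel) Z I"
    and AB: "A \<subseteq> I" "B \<subseteq> I" "A \<inter> B = {}" "finite B"
    and gauss: "\<And>k. k \<in> B \<Longrightarrow> distr M borel (Z k) = gauss 0 (v k)"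
    and v: "\<And>k. k \<in> B \<Longrightarrow> v k \<ge> 0"
    and c [measurable]: "\<And>k. k \<in> B \<Longrightarrow> c k \<in> borel_measurable (Pi\<^sub>M A (\<lambda>_. borel))"
  shows "(CLINT \<omega>|M. iexp (\<Sum>k\<in>B. c k (\<lambda>i\<in>A. Z i \<omega>) * Z k \<omega>)) =
    complex_of_real (LINT \<omega>|M. exp (- (\<Sum>k\<in>B. (c k (\<lambda>i\<in>A. Z i \<omega>))\<^sup>2 * v k) / 2))"
proof -
  let ?X = "\<lambda>\<omega>. \<lambda>i\<in>A. Z i \<omega>" and ?Y = "\<lambda>\<omega>. \<lambda>i\<in>B. Z i \<omega>"
  let ?S = "Pi\<^sub>M A (\<lambda>_. borel :: real measure)" and ?T = "Pi\<^sub>M B (\<lambda>_. borel :: real measure)"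
  let ?f = "\<lambda>(x, y). iexp (\<Sum>k\<in>B. c k x * y k)"
  \<comment> \<open>Disjoint blocks of an independent family are independent, so the joint law of
    the two blocks is the product of their laws.\<close>
  have "indep_var ?S ?X ?T ?Y"
    using indep_var_restrict[OF ind] AB by auto
  then have X [measurable]: "?X \<in> measurable M ?S" and Y [measurable]: "?Y \<in> measurable M ?T"
    and D: "distr M ?S ?X \<Otimes>\<^sub>M distr M ?T ?Y = distr M (?S \<Otimes>\<^sub>M ?T) (\<lambda>x. (?X x, ?Y x))"
    by (auto simp: indep_var_distribution_eq)
  interpret X: prob_space "distr M ?S ?X" by (rule prob_space_distr) (rule X)
  interpret Y: prob_space "distr M ?T ?Y" by (rule prob_space_distr) (rule Y)
  interpret XY: pair_prob_space "distr M ?S ?X" "distr M ?T ?Y" ..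
  have Z [measurable]: "Z k \<in> borel_measurable M" if "k \<in> B" for k
    using ind AB that by (auto simp: indep_vars_def)
  have f [measurable]: "?f \<in> borel_measurable (?S \<Otimes>\<^sub>M ?T)"
    by measurable
  have inner: "(CLINT y|distr M ?T ?Y. ?f (x, y)) =
      complex_of_real (exp (- (\<Sum>k\<in>B. (c k x)\<^sup>2 * v k) / 2))" if x: "x \<in> space ?S" for x
  proof -
    have "(CLINT y|distr M ?T ?Y. ?f (x, y)) = (CLINT \<omega>|M. ?f (x, ?Y \<omega>))"
      using x by (intro integral_distr) measurable
    also have "\<dots> = (CLINT \<omega>|M. (\<Prod>k\<in>B. iexp (c k x * Z k \<omega>)))"
      using AB(4) by (simp add: exp_sum sum_distrib_left cong: sum.cong)
    also have "\<dots> = (\<Prod>k\<in>B. CLINT \<omega>|M. iexp (c k x * Z k \<omega>))"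
    proof (rule indep_vars_lebesgue_integral)
      show "indep_vars (\<lambda>_. borel) (\<lambda>k \<omega>. iexp (c k x * Z k \<omega>)) B"
        by (rule indep_vars_compose2[OF indep_vars_subset[OF ind AB(2)]]) auto
    qed (auto intro!: AB integrable_iexp)
    also have "\<dots> = (\<Prod>k\<in>B. char (distr M borel (Z k)) (c k x))"
      unfolding char_def by (intro prod.cong) (auto simp: integral_distr)
    also have "\<dots> = (\<Prod>k\<in>B. complex_of_real (exp (- ((c k x)\<^sup>2 * v k) / 2)))"
      by (intro prod.cong) (auto simp: gauss char_gauss v)
    also have "\<dots> = complex_of_real (exp (\<Sum>k\<in>B. - ((c k x)\<^sup>2 * v k) / 2))"
      using AB(4) by (simp add: exp_sum)
    finally show ?thesis by (simp add: sum_negf sum_divide_distrib)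
  qed
  have "(CLINT \<omega>|M. iexp (\<Sum>k\<in>B. c k (?X \<omega>) * Z k \<omega>)) = (CLINT \<omega>|M. ?f (?X \<omega>, ?Y \<omega>))"
    by (simp cong: sum.cong)
  also have "\<dots> = (CLINT p|distr M (?S \<Otimes>\<^sub>M ?T) (\<lambda>x. (?X x, ?Y x)). ?f p)"
    by (intro integral_distr[symmetric]) measurable
  also have "\<dots> = (CLINT x|distr M ?S ?X. CLINT y|distr M ?T ?Y. ?f (x, y))"
    unfolding D[symmetric]
  proof (rule XY.integral_fst'[symmetric])
    \<comment> \<open>The integrand has modulus 1, and the product of the two laws carries the
      sigma-algebra for which \<open>f\<close> was stated.\<close>
    show "integrable (distr M ?S ?X \<Otimes>\<^sub>M distr M ?T ?Y) ?f"
      by (intro XY.integrable_const_bound[where B = 1] AE_I2)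
        (auto simp: measurable_cong_sets[OF sets_pair_measure_cong[OF sets_distr sets_distr] refl] f
          split: prod.split)
  qed
  also have "\<dots> = (CLINT \<omega>|M. CLINT y|distr M ?T ?Y. ?f (?X \<omega>, y))"
    using X by (intro integral_distr) (auto intro!: Y.borel_measurable_lebesgue_integral)
  also have "\<dots> = (CLINT \<omega>|M. complex_of_real (exp (- (\<Sum>k\<in>B. (c k (?X \<omega>))\<^sup>2 * v k) / 2)))"
    by (intro Bochner_Integration.integral_cong refl inner measurable_space[OF X])
  finally show ?thesis by simp
qed

section \<open>Characteristic function of the second-layer pre-activations\<close>

context random_network
begin

lemma post_act_1:
  "post_act \<phi> N w c x0 1 i = \<phi> (affine_layer N (w 1) (c 1) x0 i)"
  by simp

text \<open>All second-layer neurons use the same coefficients, the first-layer activations, but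
  disjoint sets of fresh parameters. Hence the conditional variance of the sum over \<open>S\<close>
  is \<open>card S\<close> times the common one.\<close>

lemma expectation_iexp_sum_pre_act_2:
  fixes x0 :: "nat \<Rightarrow> real"
  assumes [measurable]: "\<phi> \<in> borel_measurable borel" and D: "D \<ge> 2" and S: "S \<subseteq> {1..N}"
  shows "(CLINT \<omega>|M. iexp (\<Sum>i\<in>S. pre_act \<phi> N (\<lambda>l i j. W l i j \<omega>) (\<lambda>l i. b l i \<omega>) x0 2 i)) =
    complex_of_real (LINT \<omega>|M. exp (- (real (card S) *
      ((\<Sum>j=1..N. (post_act \<phi> N (\<lambda>l i j. W l i j \<omega>) (\<lambda>l i. b l i \<omega>) x0 1 j)\<^sup>2 * (\<sigma>w\<^sup>2 / real N))
        + \<sigma>b\<^sup>2)) / 2))"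
proof -
  define Z where "Z = case_sum (\<lambda>(l, i, j). W l i j) (\<lambda>(l, i). b l i)"
  define A :: "(nat \<times> nat \<times> nat + nat \<times> nat) set"
    where "A = ({1} \<times> {1..N} \<times> {1..N}) <+> ({1} \<times> {1..N})"
  define B :: "(nat \<times> nat \<times> nat + nat \<times> nat) set"
    where "B = ({2} \<times> S \<times> {1..N}) <+> ({2} \<times> S)"
  define x1 where "x1 j z = \<phi> (affine_layer N (\<lambda>i j. z (Inl (1, i, j))) (\<lambda>i. z (Inr (1, i))) x0 j)"
    for j and z :: "nat \<times> nat \<times> nat + nat \<times> nat \<Rightarrow> real"
  \<comment> \<open>The sum of the \<open>h_{2,i}\<close> over \<open>S\<close> is linear in the
    second-layer parameters: a weight has coefficient \<open>x1 j\<close>, a bias has coefficient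
    1.\<close>
  define c where "c = case_sum (\<lambda>(l :: nat, i :: nat, j). x1 j) (\<lambda>(l :: nat, i :: nat) z. 1)"
  define v where "v = case_sum (\<lambda>_ :: nat \<times> nat \<times> nat. \<sigma>w\<^sup>2 / real N) (\<lambda>_ :: nat \<times> nat. \<sigma>b\<^sup>2)"
  have fin: "finite S" using S finite_subset by blast
  have Z: "Z (Inl (l, i, j)) = W l i j" "Z (Inr (l, i)) = b l i" for l i j
    by (simp_all add: Z_def)
  have sum_B: "(\<Sum>k\<in>B. g k) = (\<Sum>i\<in>S. (\<Sum>j=1..N. g (Inl (2, i, j))) + g (Inr (2, i)))"
    for g :: "_ \<Rightarrow> real"
    using fin by (simp add: B_def sum.Plus sum.cartesian_product' sum.distrib)
  have x1: "x1 j (\<lambda>k\<in>A. Z k \<omega>) = post_act \<phi> N (\<lambda>l i j. W l i j \<omega>) (\<lambda>l i. b l i \<omega>) x0 1 j"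
    if "j \<in> {1..N}" for j \<omega>
  proof -
    \<comment> \<open>Every parameter read by \<open>x1 j\<close> lies in \<open>A\<close>, so
      restricting to \<open>A\<close> does not replace it by \<open>undefined\<close>.\<close>
    have "Inr (1, j) \<in> A" "\<And>k. k \<in> {1..N} \<Longrightarrow> Inl (1, j, k) \<in> A"
      using that by (auto simp: A_def)
    then show ?thesis
      unfolding post_act_1 x1_def affine_layer_def
      by (simp add: Z_def del: One_nat_def cong: sum.cong_simp)
  qed
  have x1_meas: "x1 j \<in> borel_measurable (Pi\<^sub>M A (\<lambda>_. borel))" if "j \<in> {1..N}" for j
  proof -
    have "Inr (1, j) \<in> A" "\<And>k. k \<in> {1..N} \<Longrightarrow> Inl (1, j, k) \<in> A"
      using that by (auto simp: A_def)
    then have "(\<lambda>z. affine_layer N (\<lambda>i j. z (Inl (1, i, j))) (\<lambda>i. z (Inr (1, i))) x0 j)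
        \<in> borel_measurable (Pi\<^sub>M A (\<lambda>_. borel))"
      unfolding affine_layer_def
      by (intro borel_measurable_add borel_measurable_sum borel_measurable_times
          borel_measurable_const measurable_component_singleton)
    then show ?thesis unfolding x1_def by measurable
  qed
  have "(CLINT \<omega>|M. iexp (\<Sum>k\<in>B. c k (\<lambda>i\<in>A. Z i \<omega>) * Z k \<omega>)) =
      complex_of_real (LINT \<omega>|M. exp (- (\<Sum>k\<in>B. (c k (\<lambda>i\<in>A. Z i \<omega>))\<^sup>2 * v k) / 2))"
  proof (rule expectation_iexp_random_linear_gauss)
    show "indep_vars (\<lambda>_. borel) Z (({1..D} \<times> {1..N} \<times> {1..N}) <+> ({1..D} \<times> {1..N}))"
      unfolding Z_def by (rule indep_params)
  next
    fix k assume k: "k \<in> B"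
    show "distr M borel (Z k) = gauss 0 (v k)"
      using k S D distr_W distr_b by (auto simp: B_def Z_def v_def)
    show "v k \<ge> 0" by (auto simp: v_def split: sum.split)
    show "c k \<in> borel_measurable (Pi\<^sub>M A (\<lambda>_. borel))"
      using k by (auto simp: B_def c_def intro!: x1_meas)
  qed (use S D fin in \<open>auto simp: A_def B_def\<close>)
  moreover have "(\<Sum>k\<in>B. c k (\<lambda>i\<in>A. Z i \<omega>) * Z k \<omega>) =
      (\<Sum>i\<in>S. pre_act \<phi> N (\<lambda>l i j. W l i j \<omega>) (\<lambda>l i. b l i \<omega>) x0 2 i)" for \<omega>
    unfolding sum_B pre_act_def affine_layer_def
    by (intro sum.cong arg_cong2[where f = "(+)"] refl)
      (simp_all add: c_def x1 Z mult.commute del: post_act.simps)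
  moreover have "(\<Sum>k\<in>B. (c k (\<lambda>i\<in>A. Z i \<omega>))\<^sup>2 * v k) = real (card S) *
      ((\<Sum>j=1..N. (post_act \<phi> N (\<lambda>l i j. W l i j \<omega>) (\<lambda>l i. b l i \<omega>) x0 1 j)\<^sup>2 * (\<sigma>w\<^sup>2 / real N))
        + \<sigma>b\<^sup>2)" for \<omega>
    unfolding sum_B by (simp add: c_def v_def x1 del: post_act.simps cong: sum.cong_simp)
  ultimately show ?thesis by simp
qed

section \<open>Outcomes with a prescribed sign of the whole first layer\<close>

text \<open>Prescribing the sign of every first-layer weight and bias makes each term of
  \<open>e\<close> times the pre-activation nonnegative and the weight terms positive. By
  independence this event has positive probability, so it meets every almost sure event.\<close>

lemma obtain_pre_act_1_sign:
  assumes P: "AE \<omega> in M. P \<omega>" and e: "e \<in> {-1, 1 :: real}"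
    and x0: "\<forall>i\<in>{1..N}. x0 i \<in> {-1, 1}" and pos: "\<sigma>w > 0" "N \<ge> 1" "D \<ge> 1"
  obtains \<omega> where "P \<omega>"
    "\<And>i. i \<in> {1..N} \<Longrightarrow> e * affine_layer N (\<lambda>i j. W 1 i j \<omega>) (\<lambda>i. b 1 i \<omega>) x0 i > 0"
proof -
  define Z where "Z = case_sum (\<lambda>(l, i, j). W l i j) (\<lambda>(l, i). b l i)"
  define J :: "(nat \<times> nat \<times> nat + nat \<times> nat) set"
    where "J = ({1} \<times> {1..N} \<times> {1..N}) <+> ({1} \<times> {1..N})"
  \<comment> \<open>The bias condition is weak because the bias is almost surely 0 when
    \<open>\<sigma>b = 0\<close>.\<close>
  define A where "A = case_sum (\<lambda>(l :: nat, i :: nat, j). {y. e * (y * x0 j) > 0})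
    (\<lambda>_ :: nat \<times> nat. {y. e * y \<ge> 0})"
  define E where "E = (\<Inter>k\<in>J. Z k -` A k \<inter> space M)"
  have ind: "indep_vars (\<lambda>_. borel) Z (({1..D} \<times> {1..N} \<times> {1..N}) <+> ({1..D} \<times> {1..N}))"
    unfolding Z_def by (rule indep_params)
  have J: "J \<noteq> {}" "finite J" "J \<subseteq> ({1..D} \<times> {1..N} \<times> {1..N}) <+> ({1..D} \<times> {1..N})"
    using pos by (auto simp: J_def)
  have A: "A k \<in> sets borel" for k
    by (auto simp: A_def split: sum.split)
  have Z: "Z k \<in> borel_measurable M" if "k \<in> J" for k
    using ind that J(3) by (auto simp: indep_vars_def)
  have E_sets: "E \<in> events"
    unfolding E_def using J A Z by (intro sets.finite_INT measurable_sets) auto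
  have "prob (Z k -` A k \<inter> space M) > 0" if k: "k \<in> J" for k
  proof -
    have "prob (Z k -` A k \<inter> space M) = measure (distr M borel (Z k)) (A k)"
      using A Z[OF k] by (simp add: measure_distr)
    also have "\<dots> > 0"
    proof (cases k)
      case (Inl p)
      then obtain i j where p: "k = Inl (1, i, j)" "i \<in> {1..N}" "j \<in> {1..N}"
        using k by (auto simp: J_def)
      have "x0 j = 1 \<or> x0 j = -1" using x0 p by blast
      then have "{..<0} \<subseteq> A k \<or> {0<..} \<subseteq> A k"
        using e by (auto simp: p A_def)
      moreover have "distr M borel (Z k) = gauss 0 (\<sigma>w\<^sup>2 / real N)"
        using p pos distr_W by (auto simp: Z_def)
      ultimately show ?thesis using pos A by (simp add: gauss_pos)
    next
      case (Inr p)
      then have "{..<0} \<subseteq> A k \<or> {0<..} \<subseteq> A k" "0 \<in> A k"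
        using e by (auto simp: A_def)
      moreover have "distr M borel (Z k) = gauss 0 (\<sigma>b\<^sup>2)"
        using Inr k pos distr_b by (auto simp: Z_def J_def)
      ultimately show ?thesis using A by (simp add: gauss_pos)
    qed
    finally show ?thesis .
  qed
  \<comment> \<open>Independence turns \<open>prob E\<close> into a finite product of positive
    factors.\<close>
  then have "prob E > 0"
    unfolding E_def indep_varsD[OF ind J A] by (intro prod_pos) auto
  then have "\<not> (AE \<omega> in M. \<omega> \<notin> E)"
    using prob_eq_0[OF E_sets] by simp
  then obtain \<omega> where \<omega>: "P \<omega>" "\<omega> \<in> E"
    using P by (metis (mono_tags, lifting) AE_mp AE_I2)
  show thesis
  proof (rule that)
    show "P \<omega>" by fact
  next
    fix i assume i: "i \<in> {1..N}"
    have "e * (W 1 i j \<omega> * x0 j) > 0" if "j \<in> {1..N}" for j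
    proof -
      have "Inl (1, i, j) \<in> J" using i that by (auto simp: J_def)
      then have "Z (Inl (1, i, j)) \<omega> \<in> A (Inl (1, i, j))" using \<omega>(2) unfolding E_def by blast
      then show ?thesis by (simp add: Z_def A_def)
    qed
    then have "(\<Sum>j=1..N. e * (W 1 i j \<omega> * x0 j)) > 0"
      using pos by (intro sum_pos) auto
    moreover have "e * b 1 i \<omega> \<ge> 0"
    proof -
      have "Inr (1, i) \<in> J" using i by (auto simp: J_def)
      then have "Z (Inr (1, i)) \<omega> \<in> A (Inr (1, i))" using \<omega>(2) unfolding E_def by blast
      then show ?thesis by (simp add: Z_def A_def)
    qed
    ultimately show "e * affine_layer N (\<lambda>i j. W 1 i j \<omega>) (\<lambda>i. b 1 i \<omega>) x0 i > 0"
      by (simp add: affine_layer_def distrib_left sum_distrib_left)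
  qed
qed

section \<open>Failure of independence\<close>

text \<open>The sign conditions on \<open>\<phi>\<close> are shared by ReLU and Heaviside. They make
  the conditional variance \<open>V\<close> equal to \<open>\<sigma>b\<^sup>2\<close> when the first
  layer is all negative and larger when it is all positive.\<close>

lemma pre_act_2_not_indep:
  assumes \<phi> [measurable]: "\<phi> \<in> borel_measurable borel"
    and \<phi>_neg: "\<And>z. z < 0 \<Longrightarrow> \<phi> z = 0" and \<phi>_pos: "\<And>z. z > 0 \<Longrightarrow> \<phi> z > 0"
    and "\<sigma>w > 0" "N \<ge> 2" "D \<ge> 2" and x0: "\<forall>i\<in>{1..N}. x0 i \<in> {-1, 1}"
  shows "\<not> indep_vars (\<lambda>_. borel)
    (\<lambda>i \<omega>. pre_act \<phi> N (\<lambda>l i j. W l i j \<omega>) (\<lambda>l i. b l i \<omega>) x0 2 i) {1..N}"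
proof
  let ?x = "\<lambda>i \<omega>. post_act \<phi> N (\<lambda>l i j. W l i j \<omega>) (\<lambda>l i. b l i \<omega>) x0 1 i"
  let ?h = "\<lambda>i \<omega>. pre_act \<phi> N (\<lambda>l i j. W l i j \<omega>) (\<lambda>l i. b l i \<omega>) x0 2 i"
  define V where "V \<omega> = (\<Sum>j=1..N. (?x j \<omega>)\<^sup>2 * (\<sigma>w\<^sup>2 / real N)) + \<sigma>b\<^sup>2" for \<omega>
  define U where "U \<omega> = exp (- V \<omega> / 2)" for \<omega>
  assume ind: "indep_vars (\<lambda>_. borel) ?h {1..N}"
  have h [measurable]: "?h i \<in> borel_measurable M" if "i \<in> {1..N}" for i
    using that assms by (intro measurable_pre_act) auto
  have [measurable]: "V \<in> borel_measurable M"
    unfolding V_def using assms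
    by (intro borel_measurable_add borel_measurable_sum borel_measurable_times
        borel_measurable_power measurable_post_act borel_measurable_const) auto
  have U_meas [measurable]: "U \<in> borel_measurable M" unfolding U_def by measurable
  have V_nonneg: "V \<omega> \<ge> 0" for \<omega> unfolding V_def by (intro add_nonneg_nonneg sum_nonneg) auto
  then have U: "0 \<le> U \<omega>" "U \<omega> \<le> 1" for \<omega> by (auto simp: U_def)
  have U_int: "integrable M U" "integrable M (\<lambda>\<omega>. (U \<omega>)\<^sup>2)"
    using U by (auto intro!: integrable_const_bound[where B = 1] simp: power_le_one)
  have single: "(CLINT \<omega>|M. iexp (?h i \<omega>)) = complex_of_real (expectation U)"
    if "i \<in> {1..N}" for i
    using expectation_iexp_sum_pre_act_2[OF \<phi> \<open>D \<ge> 2\<close>, of "{i}" x0] that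
    unfolding V_def[symmetric] by (simp add: U_def[abs_def])
  \<comment> \<open>For two neurons the exponent is \<open>- (2 * V) / 2\<close>, whose exponential
    is the square of \<open>U\<close>.\<close>
  have "complex_of_real (expectation (\<lambda>\<omega>. (U \<omega>)\<^sup>2)) = (CLINT \<omega>|M. iexp (\<Sum>i\<in>{1,2}. ?h i \<omega>))"
    using expectation_iexp_sum_pre_act_2[OF \<phi> \<open>D \<ge> 2\<close>, of "{1,2}" x0] \<open>N \<ge> 2\<close>
    unfolding V_def[symmetric]
    by (simp add: U_def[abs_def] power2_eq_square exp_add[symmetric] del: One_nat_def)
  also have "\<dots> = (CLINT \<omega>|M. \<Prod>i\<in>{1,2}. iexp (?h i \<omega>))"
    by (simp add: exp_add distrib_left)
  also have "\<dots> = (\<Prod>i\<in>{1,2}. CLINT \<omega>|M. iexp (?h i \<omega>))"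
  proof (rule indep_vars_lebesgue_integral)
    show "indep_vars (\<lambda>_. borel) (\<lambda>i \<omega>. iexp (?h i \<omega>)) {1, 2}"
      using \<open>N \<ge> 2\<close> by (intro indep_vars_compose2[OF indep_vars_subset[OF ind]]) auto
    show "integrable M (\<lambda>\<omega>. iexp (?h i \<omega>))" if "i \<in> {1, 2}" for i
      using that \<open>N \<ge> 2\<close> by (intro integrable_iexp borel_measurable_of_real h) auto
  qed simp
  also have "\<dots> = complex_of_real ((expectation U)\<^sup>2)"
    using \<open>N \<ge> 2\<close> by (simp add: single power2_eq_square)
  \<comment> \<open>Independence has made the second moment of \<open>U\<close> equal to the square
    of its mean.\<close>
  finally have "variance U = 0"
    using U_int by (subst variance_eq) (simp_all flip: of_real_power)
  moreover have "integrable M (\<lambda>\<omega>. (U \<omega> - expectation U)\<^sup>2)"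
    using U_int by (simp add: power2_diff)
  ultimately have "AE \<omega> in M. (U \<omega> - expectation U)\<^sup>2 = 0"
    by (subst (asm) integral_nonneg_eq_0_iff_AE) auto
  then have const: "AE \<omega> in M. U \<omega> = expectation U"
    by simp
  \<comment> \<open>Since \<open>U\<close> is almost surely its mean, both sign patterns contain an
    outcome where \<open>U\<close> takes that value.\<close>
  obtain \<omega> where \<omega>: "U \<omega> = expectation U"
    "\<And>i. i \<in> {1..N} \<Longrightarrow> 1 * affine_layer N (\<lambda>i j. W 1 i j \<omega>) (\<lambda>i. b 1 i \<omega>) x0 i > 0"
    using obtain_pre_act_1_sign[OF const, of 1 x0] assms by auto
  obtain \<omega>' where \<omega>': "U \<omega>' = expectation U"
    "\<And>i. i \<in> {1..N} \<Longrightarrow> -1 * affine_layer N (\<lambda>i j. W 1 i j \<omega>') (\<lambda>i. b 1 i \<omega>') x0 i > 0"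
    using obtain_pre_act_1_sign[OF const, of "-1" x0] assms by auto
  have "V \<omega>' = \<sigma>b\<^sup>2"
    using \<omega>'(2) \<phi>_neg unfolding V_def post_act_1 by simp
  moreover have "V \<omega> > \<sigma>b\<^sup>2"
  proof -
    have "?x j \<omega> > 0" if "j \<in> {1..N}" for j
      using \<omega>(2)[OF that] unfolding post_act_1 by (intro \<phi>_pos) simp
    then have "(?x j \<omega>)\<^sup>2 * (\<sigma>w\<^sup>2 / real N) > 0" if "j \<in> {1..N}" for j
      using that assms by (intro mult_pos_pos divide_pos_pos zero_less_power) auto
    then show ?thesis
      using \<open>N \<ge> 2\<close> unfolding V_def by (simp only: less_add_same_cancel2) (intro sum_pos; simp)
  qed
  \<comment> \<open>Equal values of \<open>U\<close> force equal values of \<open>V\<close>, since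
    exp is injective.\<close>
  ultimately show False
    using trans[OF \<omega>(1) \<omega>'(1)[symmetric]] by (simp add: U_def)
qed

end

theorem theorem10:
  fixes M :: "'a measure" and D N :: nat and \<sigma>w \<sigma>b :: real
    and W :: "nat \<Rightarrow> nat \<Rightarrow> nat \<Rightarrow> 'a \<Rightarrow> real" and b :: "nat \<Rightarrow> nat \<Rightarrow> 'a \<Rightarrow> real"
    and \<phi> :: "real \<Rightarrow> real" and x0 :: "nat \<Rightarrow> real"
  assumes "\<phi> = relu \<or> \<phi> = heaviside"
    and "\<sigma>w > 0" and "\<sigma>b \<ge> 0" and "N \<ge> 2" and "D \<ge> 2"
    and "\<forall>i\<in>{1..N}. x0 i \<in> {-1, 1}"
    and "random_network M D N \<sigma>w \<sigma>b W b"
  shows "\<not> prob_space.indep_vars M (\<lambda>_. borel)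
            (\<lambda>i \<omega>. pre_act \<phi> N (\<lambda>l i j. W l i j \<omega>) (\<lambda>l i. b l i \<omega>) x0 2 i) {1..N}"
proof -
  interpret random_network M D N \<sigma>w \<sigma>b W b by fact
  show ?thesis
    using assms(1)
    by (intro pre_act_2_not_indep assms)
      (auto simp: measurable_relu measurable_heaviside, auto simp: relu_def heaviside_def)
qed

end
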